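(* $A_{5,6}(m) = \Omega(m\log\log m)$ as $m\to\infty$, and $A_{5,2d+2}(m) = \Omega\big(\tfrac1d\, m\,\alpha_d(m)\big)$ for $d\geq 3$; the latter means that there is an absolute constant $c>0$ such that for every integer $d\geq 3$ there is $m_0(d)$ with $A_{5,2d+2}(m)\geq \frac{c}{d}\, m\,\alpha_d(m)$ for all $m\geq m_0(d)$.
   Context: All sequences are finite. A block is a contiguous, possibly empty, segment of a sequence whose letters are pairwise distinct. A sequence is on $m$ blocks if it is given as a concatenation of $m$ consecutive blocks. An alternation of length $s$ is a sequence $abab\cdots$ of length $s$ with $a \neq b$ distinct letters. A sequence avoids alternations of length $s$ if none of its (not necessarily contiguous) subsequences is an alternation of length $s$. For positive integers $s,k,m$, $A_{s,k}(m)$ denotes the maximum number of distinct letters in a sequence on $m$ blocks that avoids alternations of length $s$ and in which every letter that occurs does so at least $k$ times. The inverse Ackermann hierarchy: let $A_1(n)=2n$, and for $k\geq 2$ let $A_k(0)=1$ and $A_k(n)=A_{k-1}(A_k(n-1))$ for $n\geq 1$. Then $\alpha_k(x)=\min\{n : A_k(n)\geq x\}$ for $k \geq 1$. (These one-index functions $A_k(n)$ are unrelated to the two-index functions $A_{s,k}(m)$.) *)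

theory Defs
  imports Complex_Main "HOL-Library.Sublist" "HOL-Library.Landau_Symbols"
begin

definition on_blocks :: "nat \<Rightarrow> 'a list \<Rightarrow> bool" where
  "on_blocks m u \<longleftrightarrow> (\<exists>bs. length bs = m \<and> (\<forall>b\<in>set bs. distinct b) \<and> u = concat bs)"

definition alternation :: "'a \<Rightarrow> 'a \<Rightarrow> nat \<Rightarrow> 'a list" where
  "alternation a b s = map (\<lambda>i. if even i then a else b) [0..<s]"

definition avoids_alternations :: "nat \<Rightarrow> 'a list \<Rightarrow> bool" where
  "avoids_alternations s u \<longleftrightarrow> (\<forall>a b. a \<noteq> b \<longrightarrow> \<not> subseq (alternation a b s) u)"

definition letter_counts :: "nat \<Rightarrow> nat \<Rightarrow> nat \<Rightarrow> nat set" where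
  "letter_counts s k m =
     {card (set u) | u :: nat list. on_blocks m u \<and> avoids_alternations s u \<and>
        (\<forall>x\<in>set u. k \<le> count_list u x)}"

text \<open>The maximum need not exist for small \<open>k\<close> (for instance, \<open>letter_counts 5 1 m\<close>
  is unbounded for \<open>m \<ge> 1\<close>); in that case the value below carries no meaning.
  It exists whenever \<open>0 < s \<le> k + 1\<close>; see \<open>max_letters_attained\<close>.\<close>

definition max_letters :: "nat \<Rightarrow> nat \<Rightarrow> nat \<Rightarrow> nat" where
  "max_letters s k m = Max (letter_counts s k m)"

text \<open>The hierarchy starts at index 1; the value at index 0 is a dummy.\<close>

fun ack_hier :: "nat \<Rightarrow> nat \<Rightarrow> nat" where
  "ack_hier 0 n = 0"
| "ack_hier (Suc 0) n = 2 * n"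
| "ack_hier (Suc (Suc k)) 0 = 1"
| "ack_hier (Suc (Suc k)) (Suc n) = ack_hier (Suc k) (ack_hier (Suc (Suc k)) n)"

definition inv_ack :: "nat \<Rightarrow> nat \<Rightarrow> nat" where
  "inv_ack k x = (LEAST n. ack_hier k n \<ge> x)"

lemma alternation_Suc: "alternation a b (Suc n) = a # alternation b a n"
  unfolding alternation_def by (simp add: upt_conv_Cons map_Suc_upt[symmetric] del: upt_Suc)

lemma letter_counts_nonempty:
  assumes "s > 0" shows "0 \<in> letter_counts s k m"
proof -
  have "on_blocks m ([] :: nat list)"
    unfolding on_blocks_def by (rule exI[of _ "replicate m []"]) (auto simp: concat_eq_Nil_conv)
  moreover have "avoids_alternations s ([] :: nat list)"
    using assms by (auto simp: avoids_alternations_def alternation_def)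
  ultimately show ?thesis unfolding letter_counts_def by force
qed

lemma common_blocks_alternation:
  assumes "a \<noteq> b" "\<forall>B\<in>set bs. a \<in> set B \<longleftrightarrow> b \<in> set B" "length (filter (\<lambda>B. a \<in> set B) bs) = Suc j"
  shows "subseq (alternation a b (j + 2)) (concat bs) \<or> subseq (alternation b a (j + 2)) (concat bs)"
  using assms(2,3)
proof (induction bs arbitrary: j)
  case Nil
  then show ?case by simp
next
  case (Cons B bs)
  show ?case
  proof (cases "a \<in> set B")
    case False
    then have "subseq (alternation a b (j + 2)) (concat bs) \<or> subseq (alternation b a (j + 2)) (concat bs)"
      using Cons by auto
    then show ?thesis by (auto intro: list_emb_append2)
  next
    case True
    then have b: "b \<in> set B" using Cons.prems by auto
    show ?thesis
    proof (cases j)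
      case 0
      obtain B1 B2 where B: "B = B1 @ a # B2" using True by (auto dest: split_list)
      then consider "b \<in> set B1" | "b \<in> set B2" using b assms(1) by auto
      then have "subseq [b, a] B \<or> subseq [a, b] B"
      proof cases
        case 1
        then have "subseq ([b] @ [a]) (B1 @ a # B2)"
          by (intro list_emb_append_mono) (auto simp: subseq_singleton_left)
        then show ?thesis using B by simp
      next
        case 2
        then have "subseq ([] @ [a, b]) (B1 @ a # B2)"
          by (intro list_emb_append_mono) (auto simp: subseq_singleton_left)
        then show ?thesis using B by simp
      qed
      then have "subseq [b, a] (B @ concat bs) \<or> subseq [a, b] (B @ concat bs)"
        by (auto intro: subseq_rev_drop_many)
      moreover have "alternation x y (j + 2) = [x, y]" for x y :: 'a
        using 0 by (simp add: alternation_def upt_rec)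
      ultimately show ?thesis by auto
    next
      case (Suc i)
      have prepend: "subseq (alternation y x (j + 2)) (concat (B # bs))"
        if "y \<in> set B" "subseq (alternation x y (i + 2)) (concat bs)" for x y
      proof -
        have "subseq ([y] @ alternation x y (i + 2)) (B @ concat bs)"
          using that by (intro list_emb_append_mono) (auto simp: subseq_singleton_left)
        then show ?thesis using Suc by (simp add: alternation_Suc)
      qed
      have "subseq (alternation a b (i + 2)) (concat bs) \<or> subseq (alternation b a (i + 2)) (concat bs)"
        using Cons True Suc by auto
      then show ?thesis using prepend True b by blast
    qed
  qed
qed

lemma count_list_concat_distinct:
  "\<forall>B\<in>set bs. distinct B \<Longrightarrow> count_list (concat bs) a = length (filter (\<lambda>B. a \<in> set B) bs)"
proof (induction bs)
  case (Cons B bs)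
  have "count_list B a = (if a \<in> set B then 1 else 0)"
    if "distinct B" for B using that by (induction B) auto
  then show ?case using Cons by simp
qed simp

lemma subseq_alternation: "s \<le> n \<Longrightarrow> subseq (alternation a b s) (alternation a b n)"
proof -
  assume "s \<le> n"
  then have "alternation a b n = alternation a b s @ map (\<lambda>i. if even i then a else b) [s..<n]"
    unfolding alternation_def using upt_add_eq_append[of 0 s "n - s"] by simp
  then show ?thesis by (simp only: prefix_imp_subseq prefixI)
qed

lemma finite_letter_counts:
  assumes "s \<le> k + 1"
  shows "finite (letter_counts s k m)"
proof (rule finite_subset)
  show "letter_counts s k m \<subseteq> {..2 ^ m}"
  proof
    fix c assume "c \<in> letter_counts s k m"
    then obtain u :: "nat list" where "on_blocks m u" and u: "c = card (set u)"
      "avoids_alternations s u" "\<forall>x\<in>set u. k \<le> count_list u x"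
      unfolding letter_counts_def mem_Collect_eq by (elim exE conjE)
    then obtain bs where bs: "length bs = m" "\<forall>B\<in>set bs. distinct B" "u = concat bs"
      unfolding on_blocks_def by (elim exE conjE)
    define pos where "pos a = {i\<in>{..<m}. a \<in> set (bs ! i)}" for a
    have "inj_on pos (set u)"
    proof (rule inj_onI, rule ccontr)
      fix a b assume ab: "a \<in> set u" "b \<in> set u" "pos a = pos b" "a \<noteq> b"
      have same: "\<forall>B\<in>set bs. a \<in> set B \<longleftrightarrow> b \<in> set B"
      proof
        fix B assume "B \<in> set bs"
        then obtain i where i: "i < m" "B = bs ! i" using bs(1) by (auto simp: in_set_conv_nth)
        have "i \<in> pos a \<longleftrightarrow> i \<in> pos b" using ab(3) by simp
        then show "a \<in> set B \<longleftrightarrow> b \<in> set B" using i by (simp add: pos_def)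
      qed
      have "count_list u a \<noteq> 0" using ab(1) by (simp add: count_list_0_iff)
      then obtain j where j: "count_list u a = Suc j" using not0_implies_Suc by blast
      then have "length (filter (\<lambda>B. a \<in> set B) bs) = Suc j"
        using count_list_concat_distinct[OF bs(2)] bs(3) by metis
      from common_blocks_alternation[OF ab(4) same this]
      have alt: "subseq (alternation a b (j + 2)) u \<or> subseq (alternation b a (j + 2)) u"
        using bs(3) by simp
      have "s \<le> j + 2" using bspec[OF u(3) ab(1)] j assms by linarith
      then have "subseq (alternation a b s) u \<or> subseq (alternation b a s) u"
        using alt subseq_order.order_trans[OF subseq_alternation] by metis
      then show False
        using u(2) ab(4) unfolding avoids_alternations_def by metis
    qed
    moreover have "pos ` set u \<subseteq> Pow {..<m}" unfolding pos_def by auto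
    ultimately have "card (set u) \<le> card (Pow {..<m})" by (intro card_inj_on_le) auto
    then show "c \<in> {..2 ^ m}" using u(1) by (simp add: card_Pow)
  qed
qed simp

lemma max_letters_attained:
  assumes "0 < s" "s \<le> k + 1"
  shows "max_letters s k m \<in> letter_counts s k m"
  unfolding max_letters_def using finite_letter_counts[OF assms(2)] letter_counts_nonempty[OF assms(1)]
  by (intro Max_in) auto

end

theory Submission
  imports Defs "HOL-Library.Countable"
begin

text \<open>
  We build sequences without \<open>ababa\<close> from blocks, some of which are special: every letter has its
  first and its last occurrence in special blocks and all other occurrences elsewhere. Let \<open>Z'\<close> be
  such a sequence with \<open>f\<close> special blocks of length \<open>m\<close>, and let \<open>Z\<close> be one with special blocks of
  length \<open>f\<close>. Replace each special block of \<open>Z\<close> by a fresh copy of \<open>Z'\<close> and distribute its \<open>f\<close>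
  letters over the \<open>f\<close> special blocks of that copy, doubling each letter at the border with a
  neighbouring block. A letter \<open>a\<close> of \<open>Z\<close> is thus inserted as a contiguous \<open>aa\<close>, on one side of
  which there is no further \<open>a\<close>, so with a letter \<open>b\<close> of the copy it forms at most \<open>baba\<close> or \<open>abab\<close>;
  alternations inside \<open>Z\<close> are unaffected by the doubling. Each step lengthens the special blocks by
  one and gives the letters of \<open>Z\<close> two more occurrences.

  The recursion starts from one letter for each pair \<open>i < j < g\<close> of special blocks, with four
  occurrences. The number of blocks stays within a factor 5 of the number of special blocks, and the
  number of letters is half the number of special blocks times their length. The number of special
  blocks grows doubly exponentially in the length at the first level of the recursion, and like the
  Ackermann hierarchy above it.
\<close>

section \<open>Alternations and runs\<close>

lemma alternation_5: "alternation a b 5 = [a, b, a, b, a]"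
proof -
  have "alternation a b 0 = []" for a b :: 'a by (simp add: alternation_def)
  then show ?thesis by (simp add: numeral_eq_Suc alternation_Suc)
qed

lemma avoids_5_iff:
  "avoids_alternations 5 u \<longleftrightarrow>
     (\<forall>a\<in>set u. \<forall>b\<in>set u. a \<noteq> b \<longrightarrow> \<not> subseq [a, b, a, b, a] u)"
proof -
  have "set xs \<subseteq> set u" if "subseq xs u" for xs
    using that by (auto dest: list_emb_set)
  from this[of "[a, b, a, b, a]" for a b] show ?thesis
    unfolding avoids_alternations_def alternation_5 by auto
qed

lemma avoids_5_map_inj:
  assumes "inj f" "avoids_alternations 5 u"
  shows "avoids_alternations 5 (map f u)"
  unfolding avoids_5_iff
proof (intro ballI impI notI)
  fix c d assume "c \<in> set (map f u)" "d \<in> set (map f u)" and ne: "c \<noteq> d"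
    and sub: "subseq [c, d, c, d, c] (map f u)"
  then obtain a b where ab: "a \<in> set u" "b \<in> set u" "c = f a" "d = f b" by auto
  obtain N where "map f [a, b, a, b, a] = map f (nths u N)"
    using sub ab(3,4) unfolding subseq_conv_nths nths_map by (metis list.map)
  then have "[a, b, a, b, a] = nths u N" using assms(1) by (simp only: inj_map_eq_map)
  then have "subseq [a, b, a, b, a] u" unfolding subseq_conv_nths by blast
  then show False using assms(2) ab ne unfolding avoids_5_iff by auto
qed

text \<open>Each piece misses one of the two letters, so a word over them without equal neighbours
  takes at most one entry from each piece.\<close>

lemma length_le_number_of_runs:
  assumes "distinct_adj xs" "set xs \<subseteq> {a, b}" "subseq xs (concat us)"
    and "\<forall>u\<in>set us. a \<notin> set u \<or> b \<notin> set u"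
  shows "length xs \<le> length us"
  using assms
proof (induction us arbitrary: xs)
  case Nil
  then show ?case by simp
next
  case (Cons u us)
  then obtain xs1 xs2 where xs: "xs = xs1 @ xs2" "subseq xs1 u" "subseq xs2 (concat us)"
    by (auto simp: subseq_append_iff)
  have "length xs2 \<le> length us"
    using Cons xs by (auto simp: distinct_adj_append_iff)
  moreover have "length xs1 \<le> 1"
  proof (rule ccontr)
    assume "\<not> length xs1 \<le> 1"
    then obtain x y zs where xs1: "xs1 = x # y # zs"
      by (cases xs1; cases "tl xs1") auto
    have "set xs1 \<subseteq> set u" using xs(2) by (auto dest: list_emb_set)
    then show False using Cons.prems xs xs1 by auto
  qed
  ultimately show ?case using xs by simp
qed

text \<open>Four pieces are one fewer than the five runs of \<open>ababa\<close>. Being symmetric in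
  \<open>a\<close> and \<open>b\<close>, the condition excludes both alternations of length 5 at
  once.\<close>

definition separable :: "'a \<Rightarrow> 'a \<Rightarrow> 'a list \<Rightarrow> bool" where
  "separable a b u \<longleftrightarrow>
     (\<exists>us. length us \<le> 4 \<and> u = concat us \<and> (\<forall>v\<in>set us. a \<notin> set v \<or> b \<notin> set v))"

lemma separable_commute: "separable a b u \<longleftrightarrow> separable b a u"
  unfolding separable_def by blast

lemma separableI:
  assumes "u = u1 @ u2 @ u3 @ u4"
    and "a \<notin> set u1 \<or> b \<notin> set u1" "a \<notin> set u2 \<or> b \<notin> set u2"
    and "a \<notin> set u3 \<or> b \<notin> set u3" "a \<notin> set u4 \<or> b \<notin> set u4"
  shows "separable a b u"
  unfolding separable_def using assms by (intro exI[of _ "[u1, u2, u3, u4]"]) auto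

lemma separable_imp_no_alternation:
  assumes "separable a b u" "a \<noteq> b"
  shows "\<not> subseq [a, b, a, b, a] u"
proof
  assume sub: "subseq [a, b, a, b, a] u"
  obtain us where us: "length us \<le> 4" "u = concat us" "\<forall>v\<in>set us. a \<notin> set v \<or> b \<notin> set v"
    using assms(1) unfolding separable_def by blast
  have "length [a, b, a, b, a] \<le> length us"
    by (rule length_le_number_of_runs[where a = a and b = b]) (use sub us assms(2) in auto)
  then show False using us(1) by simp
qed

text \<open>The letters of one \<open>h t\<close> are all equal, so \<open>xs\<close> can use at
  most one of them. Hence doubling letters in place creates no new alternation.\<close>

lemma subseq_concat_repeats:
  assumes "distinct_adj xs" "subseq xs (concat (map h ts))" "\<And>t. set (h t) \<subseteq> {g t}"
  shows "subseq xs (map g ts)"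
  using assms(1,2)
proof (induction ts arbitrary: xs)
  case Nil
  then show ?case by simp
next
  case (Cons t ts)
  then obtain xs1 xs2 where xs: "xs = xs1 @ xs2" "subseq xs1 (h t)" "subseq xs2 (concat (map h ts))"
    by (auto simp: subseq_append_iff)
  have "set xs1 \<subseteq> set (h t)" using xs(2) by (auto dest: list_emb_set)
  then have single: "set xs1 \<subseteq> {g t}" using assms(3) by blast
  have "subseq xs1 [g t]"
  proof (cases xs1)
    case (Cons x ys)
    then have "ys = []"
      using \<open>distinct_adj xs\<close> xs(1) single by (cases ys) auto
    then show ?thesis using Cons single by auto
  qed simp
  moreover have "subseq xs2 (map g ts)"
    using Cons xs by (auto simp: distinct_adj_append_iff)
  ultimately have "subseq (xs1 @ xs2) ([g t] @ map g ts)" by (rule list_emb_append_mono)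
  then show ?case using xs by simp
qed

lemma subseq_filter_self:
  assumes "subseq xs u" "\<forall>x\<in>set xs. P x"
  shows "subseq xs (filter P u)"
proof -
  have "subseq (filter P xs) (filter P u)" using assms(1) by simp
  moreover have "filter P xs = xs" using assms(2) by (simp add: filter_id_conv)
  ultimately show ?thesis by simp
qed

section \<open>Sequences with special blocks\<close>

datatype tag = First | Mid | Last

text \<open>In \<open>Special X A B Y\<close> the special block is \<open>A @ B\<close>, where \<open>A\<close> consists of last and \<open>B\<close> of first
  occurrences; \<open>X\<close> and \<open>Y\<close> are the neighbouring blocks that receive the doubled letters.\<close>

datatype 'a segment = Plain "'a list" | Special "'a list" "'a list" "'a list" "'a list"

text \<open>Tags are assigned by position alone; the trace condition in \<open>scaffold\<close>
  makes them agree with actual first and last occurrences.\<close>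

fun tagged_segment :: "'a segment \<Rightarrow> (tag \<times> 'a) list" where
  "tagged_segment (Plain R) = map (Pair Mid) R"
| "tagged_segment (Special X A B Y) =
     map (Pair Mid) X @ map (Pair Last) A @ map (Pair First) B @ map (Pair Mid) Y"

fun blocks_segment :: "'a segment \<Rightarrow> 'a list list" where
  "blocks_segment (Plain R) = [R]"
| "blocks_segment (Special X A B Y) = [X, A @ B, Y]"

fun segment_ok :: "nat \<Rightarrow> 'a segment \<Rightarrow> bool" where
  "segment_ok m (Plain R) \<longleftrightarrow> distinct R"
| "segment_ok m (Special X A B Y) \<longleftrightarrow>
     distinct X \<and> distinct (A @ B) \<and> distinct Y \<and> length A + length B = m"

fun is_special :: "'a segment \<Rightarrow> bool" where
  "is_special (Plain R) \<longleftrightarrow> False"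
| "is_special (Special X A B Y) \<longleftrightarrow> True"

definition specials :: "'a segment list \<Rightarrow> nat" where
  "specials Z = length (filter is_special Z)"

definition tagged :: "'a segment list \<Rightarrow> (tag \<times> 'a) list" where
  "tagged Z = concat (map tagged_segment Z)"

definition blocks :: "'a segment list \<Rightarrow> 'a list list" where
  "blocks Z = concat (map blocks_segment Z)"

definition word :: "'a segment list \<Rightarrow> 'a list" where
  "word Z = map snd (tagged Z)"

definition trace :: "'a \<Rightarrow> (tag \<times> 'a) list \<Rightarrow> tag list" where
  "trace c w = map fst (filter (\<lambda>t. snd t = c) w)"

lemma specials_simps [simp]:
  "specials [] = 0" "specials (Plain R # Z) = specials Z"
  "specials (Special X A B Y # Z) = Suc (specials Z)"
  "specials (Z1 @ Z2) = specials Z1 + specials Z2"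
  by (simp_all add: specials_def)

lemma tagged_simps [simp]:
  "tagged [] = []" "tagged (S # Z) = tagged_segment S @ tagged Z"
  "tagged (Z1 @ Z2) = tagged Z1 @ tagged Z2"
  by (simp_all add: tagged_def)

lemma blocks_simps [simp]:
  "blocks [] = []" "blocks (S # Z) = blocks_segment S @ blocks Z"
  "blocks (Z1 @ Z2) = blocks Z1 @ blocks Z2"
  by (simp_all add: blocks_def)

lemma word_simps [simp]:
  "word [] = []" "word (Plain R # Z) = R @ word Z"
  "word (Special X A B Y # Z) = X @ A @ B @ Y @ word Z"
  "word (Z1 @ Z2) = word Z1 @ word Z2"
  by (simp_all add: word_def comp_def)

lemma trace_simps [simp]:
  "trace c [] = []" "trace c (t # w) = (if snd t = c then fst t # trace c w else trace c w)"
  "trace c (w1 @ w2) = trace c w1 @ trace c w2"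
  by (simp_all add: trace_def)

lemma concat_blocks: "concat (blocks Z) = word Z"
proof (induction Z)
  case (Cons S Z)
  then show ?case by (cases S) auto
qed simp

lemma trace_empty_iff: "trace c w = [] \<longleftrightarrow> c \<notin> snd ` set w"
  by (auto simp: trace_def filter_empty_conv)

lemma trace_word_empty_iff: "trace c (tagged Z) = [] \<longleftrightarrow> c \<notin> set (word Z)"
  by (simp add: trace_empty_iff word_def)

lemma trace_map_inj: "inj f \<Longrightarrow> trace (f c) (map (apsnd f) w) = trace c w"
  by (induction w) (auto simp: inj_eq)

lemma trace_filter: "P c \<Longrightarrow> trace c (filter (\<lambda>t. P (snd t)) w) = trace c w"
  by (induction w) auto

lemma length_trace: "length (trace c (tagged Z)) = count_list (word Z) c"
  unfolding trace_def word_def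
  by (simp add: count_list_eq_length_filter filter_map comp_def eq_commute)

text \<open>By the trace condition each letter begins in the \<open>B\<close> part of a special
  block, ends in the \<open>A\<close> part of one and lies in ordinary blocks in between, with
  \<open>n + 2\<close> occurrences in all.\<close>

definition scaffold :: "nat \<Rightarrow> nat \<Rightarrow> 'a segment list \<Rightarrow> bool" where
  "scaffold k m Z \<longleftrightarrow> (\<forall>S\<in>set Z. segment_ok m S) \<and> avoids_alternations 5 (word Z) \<and>
     (\<forall>c\<in>set (word Z). \<exists>n. k \<le> n + 2 \<and>
        trace c (tagged Z) = First # replicate n Mid @ [Last])"

section \<open>Renaming letters\<close>

lemma tagged_map_segment: "tagged (map (map_segment f) Z) = map (apsnd f) (tagged Z)"
proof (induction Z)
  case (Cons S Z)
  then show ?case by (cases S) auto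
qed simp

lemma word_map_segment: "word (map (map_segment f) Z) = map f (word Z)"
  by (simp add: word_def tagged_map_segment)

lemma specials_map_segment [simp]: "specials (map (map_segment f) Z) = specials Z"
proof (induction Z)
  case (Cons S Z)
  then show ?case by (cases S) auto
qed simp

lemma length_blocks_map_segment [simp]: "length (blocks (map (map_segment f) Z)) = length (blocks Z)"
proof (induction Z)
  case (Cons S Z)
  then show ?case by (cases S) auto
qed simp

lemma segment_ok_map: "inj f \<Longrightarrow> segment_ok m S \<Longrightarrow> segment_ok m (map_segment f S)"
  by (cases S) (auto simp: distinct_map inj_def inj_on_def)

lemma scaffold_map:
  assumes "inj f" "scaffold k m Z"
  shows "scaffold k m (map (map_segment f) Z)"
  using assms unfolding scaffold_def word_map_segment tagged_map_segment
  by (auto simp: segment_ok_map avoids_5_map_inj trace_map_inj)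

section \<open>Substituting copies for special blocks\<close>

text \<open>Every special block takes the next letter: a first occurrence goes to the border with
  \<open>Y\<close>, a last one to the border with \<open>X\<close>. The two new copies are thus
  adjacent in the word but lie in different blocks. When the letters run out, the remaining segments
  stay as they are.\<close>

fun insert_letters :: "(tag \<times> 'a) list \<Rightarrow> 'a segment list \<Rightarrow> 'a segment list" where
  "insert_letters cs [] = []"
| "insert_letters cs (Plain R # Z) = Plain R # insert_letters cs Z"
| "insert_letters [] (Special X A B Y # Z) = Special X A B Y # Z"
| "insert_letters ((k, c) # cs) (Special X A B Y # Z) =
     (if k = First then Special X A (B @ [c]) (c # Y) else Special (X @ [c]) (c # A) B Y)
     # insert_letters cs Z"

text \<open>The effect of an insertion on tags: the copy in the neighbouring block becomes an
  intermediate occurrence.\<close>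

fun dup :: "tag \<times> 'a \<Rightarrow> (tag \<times> 'a) list" where
  "dup (First, a) = [(First, a), (Mid, a)]"
| "dup (Mid, a) = [(Mid, a)]"
| "dup (Last, a) = [(Mid, a), (Last, a)]"

lemma insert_letters_Nil [simp]: "insert_letters [] Z = Z"
  by (induction "[] :: (tag \<times> 'a) list" Z rule: insert_letters.induct) auto

lemma specials_insert_letters [simp]: "specials (insert_letters cs Z) = specials Z"
  by (induction cs Z rule: insert_letters.induct) auto

lemma length_blocks_insert_letters [simp]: "length (blocks (insert_letters cs Z)) = length (blocks Z)"
  by (induction cs Z rule: insert_letters.induct) auto

lemma set_word_insert_letters: "set (word (insert_letters cs Z)) \<subseteq> snd ` set cs \<union> set (word Z)"
  by (induction cs Z rule: insert_letters.induct) auto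

lemma segment_ok_insert_letters:
  assumes "length cs = specials Z" "\<forall>S\<in>set Z. segment_ok m S" "snd ` set cs \<inter> set (word Z) = {}"
  shows "\<forall>S\<in>set (insert_letters cs Z). segment_ok (Suc m) S"
  using assms by (induction cs Z rule: insert_letters.induct) auto

lemma filter_insert_letters_old:
  assumes "\<forall>t\<in>set cs. \<not> P (snd t)" "\<forall>c\<in>set (word Z). P c"
  shows "filter (\<lambda>t. P (snd t)) (tagged (insert_letters cs Z)) = tagged Z"
  using assms
proof (induction cs Z rule: insert_letters.induct)
qed (auto simp: filter_map comp_def filter_id_conv word_def)

text \<open>\<open>insert_letters\<close> treats every tag other than \<open>First\<close> as
  \<open>Last\<close>, whereas \<open>dup\<close> leaves \<open>Mid\<close> single; hence the
  exclusion of \<open>Mid\<close>.\<close>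

lemma filter_insert_letters_new:
  assumes "length cs \<le> specials Z" "\<forall>t\<in>set cs. P (snd t) \<and> fst t \<noteq> Mid" "\<forall>c\<in>set (word Z). \<not> P c"
  shows "filter (\<lambda>t. P (snd t)) (tagged (insert_letters cs Z)) = concat (map dup cs)"
  using assms
proof (induction cs Z rule: insert_letters.induct)
  case (4 k c cs X A B Y Z)
  then show ?case by (cases k) (auto simp: filter_map comp_def)
qed (auto simp: filter_map comp_def filter_empty_conv word_def)

text \<open>The pair \<open>[a, a]\<close> serves as a piece of its own when \<open>a\<close> is
  separated from a letter of the copy.\<close>

lemma word_insert_letters_split:
  assumes "length (cs1 @ (k, a) # cs2) \<le> specials Z"
    and "a \<notin> snd ` set cs1" "a \<notin> snd ` set cs2" "a \<notin> set (word Z)"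
  shows "\<exists>v1 v2. word (insert_letters (cs1 @ (k, a) # cs2) Z) = v1 @ [a, a] @ v2 \<and>
    a \<notin> set v1 \<and> a \<notin> set v2"
  using assms
proof (induction Z arbitrary: cs1)
  case Nil
  then show ?case by simp
next
  case (Cons S Z)
  show ?case
  proof (cases S)
    case (Plain R)
    then obtain v1 v2 where "word (insert_letters (cs1 @ (k, a) # cs2) Z) = v1 @ [a, a] @ v2"
      "a \<notin> set v1" "a \<notin> set v2" using Cons.IH[of cs1] Cons.prems by auto
    then show ?thesis using Plain Cons.prems by (intro exI[of _ "R @ v1"] exI[of _ v2]) auto
  next
    case (Special X A B Y)
    show ?thesis
    proof (cases cs1)
      case Nil
      have v2: "a \<notin> set (word (insert_letters cs2 Z))"
        using set_word_insert_letters[of cs2 Z] Cons.prems Special by auto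
      show ?thesis
      proof (cases "k = First")
        case True
        then show ?thesis using Nil Special v2 Cons.prems
          by (intro exI[of _ "X @ A @ B"] exI[of _ "Y @ word (insert_letters cs2 Z)"]) auto
      next
        case False
        then show ?thesis using Nil Special v2 Cons.prems
          by (intro exI[of _ "X"] exI[of _ "A @ B @ Y @ word (insert_letters cs2 Z)"]) auto
      qed
    next
      case (Cons t cs1')
      obtain k' c' where t: "t = (k', c')" by (cases t)
      obtain v1 v2 where v: "word (insert_letters (cs1' @ (k, a) # cs2) Z) = v1 @ [a, a] @ v2"
        "a \<notin> set v1" "a \<notin> set v2" using Cons.IH[of cs1'] Cons.prems Cons Special by auto
      show ?thesis using v Cons.prems Special Cons t
        by (intro exI[of _ "(if k' = First then X @ A @ B @ [c', c'] @ Y else X @ [c', c'] @ A @ B @ Y) @ v1"]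
            exI[of _ v2]) auto
    qed
  qed
qed

text \<open>The special block \<open>A @ B\<close> is dissolved into the special blocks of a copy of
  \<open>Z'\<close>, while \<open>X\<close> and \<open>Y\<close> survive as plain blocks. The
  counter \<open>i\<close> numbers the copies and keeps their letters apart.\<close>

fun substitute :: "nat \<Rightarrow> 'b segment list \<Rightarrow> 'a segment list \<Rightarrow> ('a + nat \<times> 'b) segment list" where
  "substitute i Z' [] = []"
| "substitute i Z' (Plain R # Z) = Plain (map Inl R) # substitute i Z' Z"
| "substitute i Z' (Special X A B Y # Z) =
     Plain (map Inl X) #
     insert_letters (map (\<lambda>a. (Last, Inl a)) A @ map (\<lambda>b. (First, Inl b)) B)
       (map (map_segment (\<lambda>x. Inr (i, x))) Z') @
     Plain (map Inl Y) # substitute (Suc i) Z' Z"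

lemma substitute_append:
  "substitute i Z' (P @ Q) = substitute i Z' P @ substitute (i + specials P) Z' Q"
  by (induction i Z' P rule: substitute.induct) auto

lemma specials_substitute: "specials (substitute i Z' Z) = specials Z * specials Z'"
  by (induction i Z' Z rule: substitute.induct) auto

text \<open>Each special block gives way to the blocks of one copy; the sum on the left avoids
  truncated subtraction.\<close>

lemma length_blocks_substitute:
  "length (blocks (substitute i Z' Z)) + specials Z =
     length (blocks Z) + specials Z * length (blocks Z')"
  by (induction i Z' Z rule: substitute.induct) auto

lemma set_word_substitute:
  "set (word (substitute i Z' Z)) \<subseteq>
     Inl ` set (word Z) \<union> {Inr (j, y) | j y. i \<le> j \<and> j < i + specials Z \<and> y \<in> set (word Z')}"
proof (induction i Z' Z rule: substitute.induct)
  case (3 i Z' X A B Y Z)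
  let ?cs = "map (\<lambda>a. (Last, Inl a)) A @ map (\<lambda>b. (First, Inl b)) B"
  let ?V = "map (map_segment (\<lambda>x. Inr (i, x))) Z'"
  have "set (word (insert_letters ?cs ?V)) \<subseteq>
      Inl ` (set A \<union> set B) \<union> (\<lambda>y. Inr (i, y)) ` set (word Z')"
    using set_word_insert_letters[of ?cs ?V] by (simp add: word_map_segment image_Un image_image)
  then have "set (word (insert_letters ?cs ?V)) \<subseteq> Inl ` set (word (Special X A B Y # Z)) \<union>
      {Inr (j, y) | j y. i \<le> j \<and> j < i + specials (Special X A B Y # Z) \<and> y \<in> set (word Z')}"
    by (rule subset_trans) auto
  moreover have "set (word (substitute (Suc i) Z' Z)) \<subseteq> Inl ` set (word (Special X A B Y # Z)) \<union>
      {Inr (j, y) | j y. i \<le> j \<and> j < i + specials (Special X A B Y # Z) \<and> y \<in> set (word Z')}"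
    by (rule subset_trans[OF 3]) auto
  ultimately show ?case by (simp add: image_Un image_iff) (auto simp: image_iff)
qed auto

text \<open>If \<open>f = specials Z'\<close>, each special block of a copy gains exactly one
  letter. If \<open>f = 0\<close>, the copies stay intact; this case serves to place copies side by
  side.\<close>

lemma segment_ok_substitute:
  fixes Z :: "'a segment list" and Z' :: "'b segment list"
  assumes "\<forall>S\<in>set Z. segment_ok f S" "\<forall>S\<in>set Z'. segment_ok m S"
    and "f = specials Z' \<and> m' = Suc m \<or> f = 0 \<and> m' = m"
  shows "\<forall>S\<in>set (substitute i Z' Z). segment_ok m' S"
  using assms
proof (induction i Z' Z rule: substitute.induct)
  case (3 i Z' X A B Y Z)
  let ?cs = "map (\<lambda>a. (Last, Inl a)) A @ map (\<lambda>b. (First, Inl b)) B"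
  let ?V = "map (map_segment (\<lambda>x. Inr (i, x))) Z' :: ('a + nat \<times> 'b) segment list"
  have "\<forall>S\<in>set ?V. segment_ok m S"
    using 3 by (auto intro: segment_ok_map simp: inj_def)
  moreover have "snd ` set ?cs \<inter> set (word ?V) = {}"
    by (auto simp: word_map_segment)
  moreover have "length ?cs = specials Z' \<and> m' = Suc m \<or> ?cs = [] \<and> m' = m"
    using 3 by auto
  ultimately have "\<forall>S\<in>set (insert_letters ?cs ?V). segment_ok m' S"
    using segment_ok_insert_letters[of ?cs ?V m] by (elim disjE) simp_all
  then show ?case using 3 by (auto simp: distinct_map)
qed (auto simp: distinct_map)

section \<open>Restriction to the outer letters and to a single copy\<close>

lemma dup_apsnd: "dup (apsnd f t) = map (apsnd f) (dup t)"
  by (cases t; cases "fst t") auto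

lemma snd_dup: "u \<in> set (dup t) \<Longrightarrow> snd u = snd t"
  by (cases t; cases "fst t") auto

lemma concat_map_dup_Mid: "concat (map dup (map (Pair Mid) xs)) = map (Pair Mid) xs"
  by (induction xs) auto

lemma filter_substitute_outer:
  fixes Z :: "'a segment list" and Z' :: "'b segment list"
  assumes "\<forall>S\<in>set Z. segment_ok f S" "f \<le> specials Z'"
  shows "filter (\<lambda>t. isl (snd t)) (tagged (substitute i Z' Z)) =
    map (apsnd Inl) (concat (map dup (tagged Z)))"
  using assms
proof (induction i Z' Z rule: substitute.induct)
  case (2 i Z' R Z)
  then show ?case by (simp add: filter_map comp_def concat_map_dup_Mid)
next
  case (3 i Z' X A B Y Z)
  let ?cs = "map (\<lambda>a. (Last, Inl a)) A @ map (\<lambda>b. (First, Inl b)) B"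
  let ?V = "map (map_segment (\<lambda>x. Inr (i, x))) Z' :: ('a + nat \<times> 'b) segment list"
  have "filter (\<lambda>t. isl (snd t)) (tagged (insert_letters ?cs ?V)) = concat (map dup ?cs)"
    by (rule filter_insert_letters_new) (use 3 in \<open>auto simp: word_map_segment\<close>)
  moreover have "concat (map dup ?cs) =
      map (apsnd Inl) (concat (map dup (map (Pair Last) A @ map (Pair First) B)))"
    by (simp add: map_concat comp_def flip: dup_apsnd)
  ultimately show ?case using 3 by (simp add: filter_map comp_def concat_map_dup_Mid)
qed simp

lemma special_at:
  assumes "i < specials Z"
  obtains P X A B Y Q where "Z = P @ Special X A B Y # Q" "specials P = i"
proof -
  have "\<exists>P X A B Y Q. Z = P @ Special X A B Y # Q \<and> specials P = i"
    using assms
  proof (induction Z arbitrary: i)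
    case (Cons S Z)
    show ?case
    proof (cases S)
      case (Plain R)
      then obtain P X A B Y Q where "Z = P @ Special X A B Y # Q" "specials P = i"
        using Cons.IH[of i] Cons.prems by auto
      then show ?thesis using Plain by (intro exI[of _ "S # P"]) auto
    next
      case (Special X A B Y)
      show ?thesis
      proof (cases i)
        case 0
        then show ?thesis using Special by (intro exI[of _ "[]"] exI[of _ X] exI[of _ A] exI[of _ B] exI[of _ Y] exI[of _ Z]) simp
      next
        case (Suc j)
        then obtain P X A B Y Q where "Z = P @ Special X A B Y # Q" "specials P = j"
          using Cons.IH[of j] Cons.prems Special by auto
        then show ?thesis using Special Suc by (intro exI[of _ "S # P"]) auto
      qed
    qed
  qed simp
  then show ?thesis using that by blast
qed

text \<open>The inner copies only gain letters of \<open>Z\<close>, so the \<open>i\<close>-th copy is recovered by filtering.\<close>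

lemma filter_substitute_inner:
  fixes Z :: "'a segment list" and Z' :: "'b segment list"
  assumes "i < specials Z"
  shows "filter (\<lambda>t. \<exists>y. snd t = Inr (i, y)) (tagged (substitute 0 Z' Z)) =
    map (apsnd (\<lambda>y. Inr (i, y))) (tagged Z')"
proof -
  obtain P X A B Y Q where Z: "Z = P @ Special X A B Y # Q" "specials P = i"
    using special_at[OF assms] .
  let ?cs = "map (\<lambda>a. (Last, Inl a)) A @ map (\<lambda>b. (First, Inl b)) B"
  let ?V = "map (map_segment (\<lambda>x. Inr (i, x))) Z' :: ('a + nat \<times> 'b) segment list"
  let ?F = "filter (\<lambda>t. \<exists>y. snd t = Inr (i, y)) :: (tag \<times> ('a + nat \<times> 'b)) list \<Rightarrow> _"
  have mid: "?F (tagged (insert_letters ?cs ?V)) = tagged ?V"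
    by (rule filter_insert_letters_old) (auto simp: word_map_segment)
  have "?F (tagged W) = []" if "\<And>y. Inr (i, y) \<notin> set (word W)" for W :: "('a + nat \<times> 'b) segment list"
    using that by (force simp: filter_empty_conv word_def)
  moreover have "Inr (i, y) \<notin> set (word (substitute 0 Z' P))"
    "Inr (i, y) \<notin> set (word (substitute (Suc i) Z' Q))" for y
    using set_word_substitute[of 0 Z' P] set_word_substitute[of "Suc i" Z' Q] Z(2) by auto
  ultimately have "?F (tagged (substitute 0 Z' P)) = []"
    "?F (tagged (substitute (Suc i) Z' Q)) = []" by blast+
  then show ?thesis using mid Z
    by (simp add: substitute_append filter_map comp_def tagged_map_segment)
qed

lemma trace_dup:
  "trace c (concat (map dup w)) =
     concat (map (\<lambda>k. case k of First \<Rightarrow> [First, Mid] | Mid \<Rightarrow> [Mid] | Last \<Rightarrow> [Mid, Last]) (trace c w))"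
proof (induction w)
  case (Cons t w)
  obtain k d where "t = (k, d)" by (cases t)
  then show ?case using Cons by (cases k) simp_all
qed simp

lemma First_only_at_head:
  assumes "us @ First # vs = First # replicate n Mid @ [Last]"
  shows "us = []"
proof (cases us)
  case (Cons u us')
  then have "us' @ First # vs = replicate n Mid @ [Last]" using assms by simp
  then have "First \<in> set (replicate n Mid @ [Last])" by (metis in_set_conv_decomp)
  then show ?thesis by simp
qed

lemma Last_only_at_end:
  assumes "us @ Last # vs = First # replicate n Mid @ [Last]"
  shows "vs = []"
proof (cases vs rule: rev_exhaust)
  case (snoc vs' v)
  then have "(us @ Last # vs') @ [v] = (First # replicate n Mid) @ [Last]" using assms by simp
  then have "us @ Last # vs' = First # replicate n Mid" by (simp only: append1_eq_conv)
  then have "Last \<in> set (First # replicate n Mid)" by (metis in_set_conv_decomp)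
  then show ?thesis by simp
qed

text \<open>Only the \<open>i\<close>-th copy contains the inner letter. If the outer letter is
  absent from the special block that the copy replaces, cuts before and after the copy suffice. If
  it has its last occurrence there, none of it follows the inserted pair, and the pieces are: before
  the copy, the copy up to the pair, the pair, the rest. A first occurrence is the mirror
  image.\<close>

lemma separable_substitute:
  fixes Z :: "'a segment list" and Z' :: "'b segment list"
  assumes ok: "\<forall>S\<in>set Z. segment_ok f S" and f: "f \<le> specials Z'"
    and trace: "\<forall>c\<in>set (word Z).
      \<exists>n. trace c (tagged Z) = First # replicate n Mid @ [Last]"
    and i: "i < specials Z"
  shows "separable (Inl a) (Inr (i, y)) (word (substitute 0 Z' Z))"
proof -
  let ?a = "Inl a :: 'a + nat \<times> 'b"
  let ?b = "Inr (i, y) :: 'a + nat \<times> 'b"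
  obtain P X A B Y Q where Z: "Z = P @ Special X A B Y # Q" "specials P = i"
    using special_at[OF i] .
  let ?cs = "map (\<lambda>a. (Last, Inl a)) A @ map (\<lambda>b. (First, Inl b)) B"
  let ?V = "map (map_segment (\<lambda>x. Inr (i, x))) Z' :: ('a + nat \<times> 'b) segment list"
  let ?v = "word (insert_letters ?cs ?V)"
  define p where "p = word (substitute 0 Z' P) @ map Inl X"
  define q where "q = map Inl Y @ word (substitute (Suc i) Z' Q)"
  have w: "word (substitute 0 Z' Z) = p @ ?v @ q"
    using Z by (simp add: substitute_append p_def q_def)
  have b: "?b \<notin> set p" "?b \<notin> set q"
    using set_word_substitute[of 0 Z' P] set_word_substitute[of "Suc i" Z' Q] Z(2)
    by (auto simp: p_def q_def)
  have dist: "distinct (A @ B)" and len: "length A + length B \<le> specials Z'"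
    using ok f Z by auto
  have pa: "?a \<in> set p \<longleftrightarrow> False" if "a \<notin> set (word P)" "a \<notin> set X"
    using set_word_substitute[of 0 Z' P] that by (auto simp: p_def)
  have qa: "?a \<in> set q \<longleftrightarrow> False" if "a \<notin> set (word Q)" "a \<notin> set Y"
    using set_word_substitute[of "Suc i" Z' Q] that by (auto simp: q_def)
  consider "a \<notin> set (A @ B)" | "a \<in> set A" | "a \<in> set B" by auto
  then show ?thesis
  proof cases
    case 1
    then have "?a \<notin> set ?v"
      using set_word_insert_letters[of ?cs ?V] by (auto simp: word_map_segment)
    moreover have "word (substitute 0 Z' Z) = p @ ?v @ q @ []" using w by simp
    ultimately show ?thesis using b by (intro separableI) auto
  next
    case 2
    then obtain A1 A2 where A: "A = A1 @ a # A2" by (auto dest: split_list)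
    obtain n where "trace a (tagged Z) = First # replicate n Mid @ [Last]"
      using trace Z 2 by auto
    moreover have "trace a (tagged Z) =
        trace a (tagged P @ map (Pair Mid) X @ map (Pair Last) A1) @
        Last # trace a (map (Pair Last) A2 @ map (Pair First) B @ map (Pair Mid) Y @ tagged Q)"
      using Z A by simp
    ultimately have "trace a (map (Pair Last) A2 @ map (Pair First) B @ map (Pair Mid) Y @ tagged Q) = []"
      by (metis Last_only_at_end)
    then have "a \<notin> set (word Q)" "a \<notin> set Y"
      by (auto simp: trace_empty_iff word_def image_image)
    then have q: "?a \<notin> set q" using qa by simp
    have "\<exists>v1 v2. word (insert_letters (map (\<lambda>a. (Last, Inl a)) A1 @ (Last, ?a) #
        (map (\<lambda>a. (Last, Inl a)) A2 @ map (\<lambda>b. (First, Inl b)) B)) ?V) = v1 @ [?a, ?a] @ v2 \<and>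
      ?a \<notin> set v1 \<and> ?a \<notin> set v2"
      by (rule word_insert_letters_split) (use A dist len in \<open>auto simp: word_map_segment\<close>)
    then obtain v1 v2 where v: "?v = v1 @ [?a, ?a] @ v2" "?a \<notin> set v1" "?a \<notin> set v2"
      using A by auto
    then have "word (substitute 0 Z' Z) = p @ v1 @ [?a, ?a] @ (v2 @ q)" using w by simp
    then show ?thesis by (rule separableI) (use v b q in auto)
  next
    case 3
    then obtain B1 B2 where B: "B = B1 @ a # B2" by (auto dest: split_list)
    obtain n where "trace a (tagged Z) = First # replicate n Mid @ [Last]"
      using trace Z 3 by auto
    moreover have "trace a (tagged Z) =
        trace a (tagged P @ map (Pair Mid) X @ map (Pair Last) A @ map (Pair First) B1) @
        First # trace a (map (Pair First) B2 @ map (Pair Mid) Y @ tagged Q)"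
      using Z B by simp
    ultimately have "trace a (tagged P @ map (Pair Mid) X @ map (Pair Last) A @ map (Pair First) B1) = []"
      by (metis First_only_at_head)
    then have "a \<notin> set (word P)" "a \<notin> set X"
      by (auto simp: trace_empty_iff word_def image_image)
    then have p: "?a \<notin> set p" using pa by simp
    have "\<exists>v1 v2. word (insert_letters ((map (\<lambda>a. (Last, Inl a)) A @ map (\<lambda>b. (First, Inl b)) B1) @
        (First, ?a) # map (\<lambda>b. (First, Inl b)) B2) ?V) = v1 @ [?a, ?a] @ v2 \<and>
      ?a \<notin> set v1 \<and> ?a \<notin> set v2"
      by (rule word_insert_letters_split) (use B dist len in \<open>auto simp: word_map_segment\<close>)
    then obtain v1 v2 where v: "?v = v1 @ [?a, ?a] @ v2" "?a \<notin> set v1" "?a \<notin> set v2"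
      using B by auto
    then have "word (substitute 0 Z' Z) = (p @ v1) @ [?a, ?a] @ v2 @ q" using w by simp
    then show ?thesis by (rule separableI) (use v b p in auto)
  qed
qed

text \<open>For two outer letters, doubling is harmless. An outer and an inner letter are separable.
  For two letters of one copy, filtering recovers \<open>Z'\<close>. Letters of different copies do
  not interleave.\<close>

lemma avoids_5_substitute:
  fixes Z :: "'a segment list" and Z' :: "'b segment list"
  assumes Z: "scaffold k f Z" and Z': "scaffold k' m Z'" and f: "f \<le> specials Z'"
  shows "avoids_alternations 5 (word (substitute 0 Z' Z))"
  unfolding avoids_5_iff
proof (intro ballI impI)
  let ?W = "substitute 0 Z' Z"
  fix c d assume c: "c \<in> set (word ?W)" and d: "d \<in> set (word ?W)" and ne: "c \<noteq> d"
  have ok: "\<forall>S\<in>set Z. segment_ok f S"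
    and trace: "\<forall>c\<in>set (word Z). \<exists>n. trace c (tagged Z) = First # replicate n Mid @ [Last]"
    using Z unfolding scaffold_def by blast+
  note sep = separable_substitute[OF ok f trace]
  have idx: "i < specials Z" if "Inr (i, x) \<in> set (word ?W)" for i x
    using that set_word_substitute[of 0 Z' Z] by auto
  show "\<not> subseq [c, d, c, d, c] (word ?W)"
  proof (cases c)
    case ca: (Inl a)
    show ?thesis
    proof (cases d)
      case da: (Inl b)
      show ?thesis
      proof
        assume "subseq [c, d, c, d, c] (word ?W)"
        then have "subseq [c, d, c, d, c] (filter isl (word ?W))"
          by (rule subseq_filter_self) (simp add: ca da)
        also have "filter isl (word ?W) = map snd (map (apsnd Inl) (concat (map dup (tagged Z))))"
          unfolding word_def filter_map comp_def filter_substitute_outer[OF ok f] ..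
        also have "\<dots> = concat (map (\<lambda>t. map (Inl \<circ> snd) (dup t)) (tagged Z))"
          by (simp add: map_concat comp_def)
        finally have "subseq [c, d, c, d, c] (map (Inl \<circ> snd) (tagged Z))"
          by (rule subseq_concat_repeats[rotated])
            (use ne in \<open>auto simp: ca da dest: snd_dup\<close>)
        then have "subseq [c, d, c, d, c] (map Inl (word Z))"
          by (simp only: word_def map_map)
        moreover have "avoids_alternations 5 (map Inl (word Z) :: ('a + nat \<times> 'b) list)"
          using Z by (intro avoids_5_map_inj) (auto simp: scaffold_def)
        ultimately show False using ne
          unfolding avoids_alternations_def alternation_5 ca da by auto
      qed
    next
      case db: (Inr p)
      obtain i y where p: "p = (i, y)" by (cases p)
      have "separable c d (word ?W)" unfolding ca db p
        by (rule sep) (use idx d db p in simp)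
      then show ?thesis using ne by (rule separable_imp_no_alternation)
    qed
  next
    case cb: (Inr p)
    obtain i x where p: "p = (i, x)" by (cases p)
    show ?thesis
    proof (cases d)
      case da: (Inl a)
      have "separable d c (word ?W)" unfolding cb da p
        by (rule sep) (use idx c cb p in simp)
      then show ?thesis using ne separable_imp_no_alternation separable_commute by metis
    next
      case db: (Inr q)
      obtain j y where q: "q = (j, y)" by (cases q)
      have i: "i < specials Z" using idx c cb p by simp
      show ?thesis
      proof (cases "i = j")
        case True
        show ?thesis
        proof
          let ?P = "\<lambda>c :: 'a + nat \<times> 'b. \<exists>y. c = Inr (i, y)"
          assume "subseq [c, d, c, d, c] (word ?W)"
          then have "subseq [c, d, c, d, c] (filter ?P (word ?W))"
            by (rule subseq_filter_self) (simp add: cb db p q True)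
          also have "filter ?P (word ?W) = map (\<lambda>y. Inr (i, y)) (word Z')"
            unfolding word_def filter_map comp_def filter_substitute_inner[OF i] by simp
          finally have "subseq [c, d, c, d, c] (map (\<lambda>y. Inr (i, y)) (word Z'))" .
          moreover have "avoids_alternations 5 (map (\<lambda>y. Inr (i, y)) (word Z') :: ('a + nat \<times> 'b) list)"
            using Z' by (intro avoids_5_map_inj) (auto simp: scaffold_def inj_def)
          ultimately show False using ne
            unfolding avoids_alternations_def alternation_5 by auto
        qed
      next
        case False
        obtain P X A B Y Q where Zs: "Z = P @ Special X A B Y # Q" "specials P = i"
          using special_at[OF i] .
        let ?v = "word (insert_letters (map (\<lambda>a. (Last, Inl a)) A @ map (\<lambda>b. (First, Inl b)) B)
          (map (map_segment (\<lambda>x. Inr (i, x))) Z'))"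
        have "word ?W = (word (substitute 0 Z' P) @ map Inl X) @ ?v @
            (map Inl Y @ word (substitute (Suc i) Z' Q)) @ []"
          using Zs by (simp add: substitute_append)
        then have "separable c d (word ?W)"
          using set_word_substitute[of 0 Z' P] set_word_substitute[of "Suc i" Z' Q] Zs(2) False
            set_word_insert_letters[of "map (\<lambda>a. (Last, Inl a)) A @ map (\<lambda>b. (First, Inl b)) B"
              "map (map_segment (\<lambda>x. Inr (i, x))) Z'"]
          by (elim separableI) (auto simp: cb db p q word_map_segment)
        then show ?thesis using ne by (rule separable_imp_no_alternation)
      qed
    qed
  qed
qed

lemma trace_substitute_outer:
  assumes "\<forall>S\<in>set Z. segment_ok f S" "f \<le> specials Z'"
    and "trace a (tagged Z) = First # replicate n Mid @ [Last]"
  shows "trace (Inl a) (tagged (substitute 0 Z' Z)) = First # replicate (n + 2) Mid @ [Last]"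
proof -
  let ?W = "tagged (substitute 0 Z' Z)"
  have "concat (replicate n [Mid]) = replicate n Mid" by (induction n) auto
  moreover have "trace (Inl a) ?W = trace (Inl a) (filter (\<lambda>t. isl (snd t)) ?W)"
    by (rule trace_filter[symmetric]) simp
  ultimately show ?thesis
    unfolding filter_substitute_outer[OF assms(1,2)]
    by (simp add: trace_map_inj trace_dup assms(3) replicate_append_same)
qed

lemma trace_substitute_inner:
  assumes "i < specials Z"
  shows "trace (Inr (i, y)) (tagged (substitute 0 Z' Z)) = trace y (tagged Z')"
proof -
  let ?W = "tagged (substitute 0 Z' Z)"
  have "trace (Inr (i, y)) ?W = trace (Inr (i, y)) (filter (\<lambda>t. \<exists>y. snd t = Inr (i, y)) ?W)"
    by (rule trace_filter[symmetric]) simp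
  also have "\<dots> = trace y (tagged Z')"
    unfolding filter_substitute_inner[OF assms] by (rule trace_map_inj) (simp add: inj_def)
  finally show ?thesis .
qed

text \<open>The outer letters have at least \<open>k\<close> occurrences and gain two, which matches
  the \<open>k + 2\<close> of the copies.\<close>

lemma scaffold_substitute:
  assumes Z: "scaffold k f Z" and Z': "scaffold (k + 2) m Z'"
    and f: "f = specials Z' \<and> m' = Suc m \<or> f = 0 \<and> m' = m"
  shows "scaffold (k + 2) m' (substitute 0 Z' Z)"
  unfolding scaffold_def
proof (intro conjI)
  have ok: "\<forall>S\<in>set Z. segment_ok f S" using Z by (simp add: scaffold_def)
  have f': "f \<le> specials Z'" using f by auto
  show "\<forall>S\<in>set (substitute 0 Z' Z). segment_ok m' S"
    using ok Z' f by (intro segment_ok_substitute) (auto simp: scaffold_def)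
  show "avoids_alternations 5 (word (substitute 0 Z' Z))"
    using Z Z' f' by (rule avoids_5_substitute)
  show "\<forall>c\<in>set (word (substitute 0 Z' Z)). \<exists>n. k + 2 \<le> n + 2 \<and>
      trace c (tagged (substitute 0 Z' Z)) = First # replicate n Mid @ [Last]"
  proof
    fix c assume "c \<in> set (word (substitute 0 Z' Z))"
    then consider a where "c = Inl a" "a \<in> set (word Z)"
      | i y where "c = Inr (i, y)" "i < specials Z" "y \<in> set (word Z')"
      using set_word_substitute[of 0 Z' Z] by auto
    then show "\<exists>n. k + 2 \<le> n + 2 \<and>
        trace c (tagged (substitute 0 Z' Z)) = First # replicate n Mid @ [Last]"
    proof cases
      case 1
      then obtain n where "k \<le> n + 2" "trace a (tagged Z) = First # replicate n Mid @ [Last]"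
        using Z unfolding scaffold_def by blast
      then show ?thesis using trace_substitute_outer[OF ok f'] 1 by (intro exI[of _ "n + 2"]) auto
    next
      case 2
      then show ?thesis using Z' trace_substitute_inner[OF 2(2)] unfolding scaffold_def by metis
    qed
  qed
qed

section \<open>The base sequence\<close>

lemma trace_map_Pair:
  "distinct xs \<Longrightarrow> trace c (map (Pair t) xs) = (if c \<in> set xs then [t] else [])"
  by (induction xs) auto

text \<open>The letter \<open>(i, j)\<close> with \<open>i < j < g\<close> occurs in the special block of hub \<open>i\<close> and right after it, and
  right before the special block of hub \<open>j\<close> and in it. Of two adjacent blocks, one lists the letters
  they share in increasing and the other in decreasing order: this is what keeps letters
  with a common hub from alternating too often.\<close>

definition hub :: "nat \<Rightarrow> nat \<Rightarrow> (nat \<times> nat) segment" where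
  "hub g i = Special (map (\<lambda>j. (j, i)) (rev [0..<i])) (map (\<lambda>j. (j, i)) [0..<i])
     (map (Pair i) [Suc i..<g]) (map (Pair i) (rev [Suc i..<g]))"

abbreviation hubs :: "nat \<Rightarrow> nat list \<Rightarrow> (nat \<times> nat) segment list" where
  "hubs g is \<equiv> map (hub g) is"

lemma word_hub_Cons:
  "word (hub g i # Z) = map (\<lambda>j. (j, i)) (rev [0..<i]) @ map (\<lambda>j. (j, i)) [0..<i] @
     map (Pair i) [Suc i..<g] @ map (Pair i) (rev [Suc i..<g]) @ word Z"
  by (simp add: hub_def)

lemma mem_word_hubs:
  "(a, b) \<in> set (word (hubs g is)) \<longleftrightarrow> a < b \<and> (a \<in> set is \<and> b < g \<or> b \<in> set is)"
  by (induction "is") (auto simp: word_hub_Cons)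

lemma upt_split: "i \<le> j \<Longrightarrow> j \<le> k \<Longrightarrow> [i..<k] = [i..<j] @ [j..<k]"
  by (metis le_add_diff_inverse upt_add_eq_append)

lemma upt_split_Cons: "i \<le> j \<Longrightarrow> j < k \<Longrightarrow> [i..<k] = [i..<j] @ j # [Suc j..<k]"
  by (metis less_imp_le_nat upt_conv_Cons upt_split)

text \<open>A letter \<open>(i, j)\<close> occurs only at hubs \<open>i\<close> and
  \<open>j\<close>, so disjoint, nested and crossing pairs are separated by cuts between hubs. A
  common hub requires a cut inside it; if it is the upper or the lower hub of both letters, the
  order within its blocks matters.\<close>

lemma separable_hubs:
  assumes "i < j" "j < g" "k < l" "l < g" "i < k \<or> i = k \<and> j < l"
  shows "separable (i, j) (k, l) (word (hubs g [0..<g]))"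
proof -
  consider "j < k" | "i < k" "j = k" | "i < k" "k < j" "l < j" | "i < k" "k < j" "l = j"
    | "i < k" "k < j" "j < l" | "i = k" "j < l"
    using assms by linarith
  then show ?thesis
  proof cases
    case 1
    have "[0..<g] = [0..<k] @ [k..<g]" by (rule upt_split) (use assms in auto)
    then have "word (hubs g [0..<g]) = word (hubs g [0..<k]) @ word (hubs g [k..<g]) @ [] @ []"
      by simp
    then show ?thesis by (rule separableI) (use assms 1 in \<open>auto simp: mem_word_hubs\<close>)
  next
    case 2
    have "[0..<g] = [0..<j] @ j # [Suc j..<g]" by (rule upt_split_Cons) (use assms in auto)
    then have "word (hubs g [0..<g]) =
        (word (hubs g [0..<j]) @ map (\<lambda>i. (i, j)) (rev [0..<j]) @ map (\<lambda>i. (i, j)) [0..<j]) @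
        (map (Pair j) [Suc j..<g] @ map (Pair j) (rev [Suc j..<g]) @ word (hubs g [Suc j..<g])) @ [] @ []"
      by (simp add: word_hub_Cons)
    then show ?thesis by (rule separableI) (use assms 2 in \<open>auto simp: mem_word_hubs\<close>)
  next
    case 3
    have "[0..<g] = [0..<k] @ [k..<j] @ [j..<g]"
      using assms 3 upt_split[of 0 k g] upt_split[of k j g] by simp
    then have "word (hubs g [0..<g]) =
        word (hubs g [0..<k]) @ word (hubs g [k..<j]) @ word (hubs g [j..<g]) @ []"
      by simp
    then show ?thesis by (rule separableI) (use assms 3 in \<open>auto simp: mem_word_hubs\<close>)
  next
    \<comment> \<open>With \<open>x = (i, j)\<close> and \<open>y = (k, j)\<close>: \<open>x\<close>
      at hub \<open>i\<close>, \<open>y\<close> at hub \<open>k\<close>, and \<open>y x x y\<close>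
      at hub \<open>j\<close>, which makes the four runs \<open>x\<close>, \<open>y\<close>,
      \<open>x\<close>, \<open>y\<close>.\<close>
    case 4
    have split: "[0..<g] = [0..<k] @ [k..<j] @ j # [Suc j..<g]"
      using assms 4 upt_split[of 0 k g] upt_split_Cons[of k j g] by simp
    have "[0..<j] = [0..<k] @ [k..<j]" by (rule upt_split) (use 4 in auto)
    then have "word (hubs g [0..<g]) =
        word (hubs g [0..<k]) @
        (word (hubs g [k..<j]) @ map (\<lambda>i. (i, j)) (rev [k..<j])) @
        (map (\<lambda>i. (i, j)) (rev [0..<k]) @ map (\<lambda>i. (i, j)) [0..<k]) @
        (map (\<lambda>i. (i, j)) [k..<j] @ map (Pair j) [Suc j..<g] @ map (Pair j) (rev [Suc j..<g]) @
          word (hubs g [Suc j..<g]))"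
      unfolding split by (simp add: word_hub_Cons)
    then show ?thesis by (rule separableI) (use assms 4 in \<open>auto simp: mem_word_hubs\<close>)
  next
    case 5
    have "[0..<g] = [0..<k] @ [k..<j] @ [j..<l] @ [l..<g]"
      using assms 5 upt_split[of 0 k g] upt_split[of k j g] upt_split[of j l g] by simp
    then have "word (hubs g [0..<g]) =
        word (hubs g [0..<k]) @ word (hubs g [k..<j]) @ word (hubs g [j..<l]) @ word (hubs g [l..<g])"
      by simp
    then show ?thesis by (rule separableI) (use assms 5 in \<open>auto simp: mem_word_hubs\<close>)
  next
    \<comment> \<open>With \<open>x = (i, j)\<close> and \<open>y = (i, l)\<close>:
      \<open>x y y x\<close> at hub \<open>i\<close>, then \<open>x\<close> at hub \<open>j\<close>
      and \<open>y\<close> at hub \<open>l\<close>, again the four runs \<open>x\<close>,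
      \<open>y\<close>, \<open>x\<close>, \<open>y\<close>.\<close>
    case 6
    have split: "[0..<g] = [0..<i] @ i # [Suc i..<g]" by (rule upt_split_Cons) (use assms in auto)
    have "[Suc i..<g] = [Suc i..<l] @ [l..<g]" by (rule upt_split) (use assms 6 in auto)
    then have "word (hubs g [0..<g]) =
        (word (hubs g [0..<i]) @ map (\<lambda>j. (j, i)) (rev [0..<i]) @ map (\<lambda>j. (j, i)) [0..<i] @
          map (Pair i) [Suc i..<l]) @
        (map (Pair i) [l..<g] @ map (Pair i) (rev [l..<g])) @
        (map (Pair i) (rev [Suc i..<l]) @ word (hubs g [Suc i..<l])) @
        word (hubs g [l..<g])"
      unfolding split by (simp add: word_hub_Cons)
    then show ?thesis by (rule separableI) (use assms 6 in \<open>auto simp: mem_word_hubs\<close>)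
  qed
qed

lemma trace_hub:
  assumes "i < j" "j < g"
  shows "trace (i, j) (tagged_segment (hub g k)) =
    (if k = i then [First, Mid] else if k = j then [Mid, Last] else [])"
  using assms unfolding hub_def tagged_segment.simps trace_simps
  by (subst (1 2 3 4) trace_map_Pair) (auto simp: distinct_map inj_on_def)

lemma trace_hubs:
  assumes "i < j" "j < g"
  shows "trace (i, j) (tagged (hubs g [0..<g])) = [First, Mid, Mid, Last]"
proof -
  have nil: "trace (i, j) (tagged (hubs g is)) = []" if "i \<notin> set is" "j \<notin> set is" for "is"
    using that by (simp add: trace_word_empty_iff mem_word_hubs)
  have "[0..<g] = [0..<i] @ i # [Suc i..<j] @ j # [Suc j..<g]"
    using assms upt_split_Cons[of 0 i g] upt_split_Cons[of "Suc i" j g] by simp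
  then show ?thesis using assms by (simp add: nil trace_hub)
qed

lemma scaffold_hubs: "scaffold 4 (g - 1) (hubs g [0..<g])"
  unfolding scaffold_def
proof (intro conjI ballI)
  fix S assume "S \<in> set (hubs g [0..<g])"
  then show "segment_ok (g - 1) S" by (auto simp: hub_def distinct_map inj_on_def)
next
  show "avoids_alternations 5 (word (hubs g [0..<g]))"
    unfolding avoids_5_iff
  proof (intro ballI impI)
    fix c d assume "c \<in> set (word (hubs g [0..<g]))" "d \<in> set (word (hubs g [0..<g]))" "c \<noteq> d"
    moreover obtain i j k l where ijkl: "c = (i, j)" "d = (k, l)" by (cases c; cases d)
    ultimately have *: "i < j" "j < g" "k < l" "l < g" "(i, j) \<noteq> (k, l)"
      by (auto simp: mem_word_hubs)
    then have "i < k \<or> k < i \<or> i = k \<and> (j < l \<or> l < j)" by (auto simp: neq_iff)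
    then consider "i < k \<or> i = k \<and> j < l" | "k < i \<or> k = i \<and> l < j" by blast
    then have "separable c d (word (hubs g [0..<g]))"
      using separable_hubs[of i j g k l] separable_hubs[of k l g i j] *
      by cases (auto simp: ijkl separable_commute)
    then show "\<not> subseq [c, d, c, d, c] (word (hubs g [0..<g]))"
      using \<open>c \<noteq> d\<close> by (rule separable_imp_no_alternation)
  qed
next
  fix c assume "c \<in> set (word (hubs g [0..<g]))"
  moreover obtain i j where "c = (i, j)" by (cases c)
  ultimately have "trace c (tagged (hubs g [0..<g])) = First # replicate 2 Mid @ [Last]"
    using trace_hubs[of i j g] by (auto simp: mem_word_hubs numeral_2_eq_2)
  then show "\<exists>n. 4 \<le> n + 2 \<and> trace c (tagged (hubs g [0..<g])) = First # replicate n Mid @ [Last]"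
    by (intro exI[of _ 2]) simp
qed

lemma specials_hubs: "specials (hubs g is) = length is"
  by (induction "is") (auto simp: hub_def)

lemma length_blocks_hubs: "length (blocks (hubs g is)) = 3 * length is"
  by (induction "is") (auto simp: hub_def)

section \<open>Iterating the substitution\<close>

abbreviation vacant :: "nat \<Rightarrow> 'a segment list" where
  "vacant n \<equiv> replicate n (Special [] [] [] [])"

lemma word_vacant: "word (vacant n) = []"
  by (induction n) auto

lemma specials_vacant: "specials (vacant n) = n"
  by (induction n) auto

lemma length_blocks_vacant: "length (blocks (vacant n)) = 3 * n"
  by (induction n) auto

lemma scaffold_vacant: "scaffold k 0 (vacant n)"
  unfolding scaffold_def word_vacant by (auto simp: avoids_5_iff)

text \<open>Level \<open>d\<close> consists of letters with \<open>2 * d + 4\<close> occurrences; it corresponds to level \<open>d + 1\<close> of the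
  hierarchy \<open>ack_hier\<close>. From level 1 on, two empty special blocks suffice as a start.\<close>

fun scaffold_size :: "nat \<Rightarrow> nat \<Rightarrow> nat" where
  "scaffold_size 0 m = Suc m"
| "scaffold_size (Suc d) 0 = 2"
| "scaffold_size (Suc d) (Suc m) =
     scaffold_size (Suc d) m * scaffold_size d (scaffold_size (Suc d) m)"

lemma scaffold_size_gt: "m < scaffold_size d m"
proof (induction d m rule: scaffold_size.induct)
  case (3 d m)
  let ?f = "scaffold_size (Suc d) m"
  have "Suc m * 2 \<le> ?f * scaffold_size d ?f"
    using 3 by (intro mult_le_mono) auto
  then show ?case by simp
qed auto

lemma scaffold_size_mono: "m \<le> n \<Longrightarrow> scaffold_size (Suc d) m \<le> scaffold_size (Suc d) n"
proof (rule lift_Suc_mono_le[of "scaffold_size (Suc d)"])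
  fix m
  show "scaffold_size (Suc d) m \<le> scaffold_size (Suc d) (Suc m)"
    using scaffold_size_gt[of "scaffold_size (Suc d) m" d] by simp
qed

text \<open>Substitution turns the letter type into a sum; renaming to \<open>nat\<close> allows an
  induction over a fixed type.\<close>

lemma scaffold_to_nat:
  fixes Z :: "'a :: countable segment list"
  assumes "scaffold k m Z"
  obtains Z' :: "nat segment list" where "scaffold k m Z'" "specials Z' = specials Z"
    "length (blocks Z') = length (blocks Z)"
proof
  show "scaffold k m (map (map_segment to_nat) Z)" using assms by (intro scaffold_map) auto
qed simp_all

text \<open>The slack 4 makes the block bound reproduce itself: if \<open>g\<close> special blocks
  among \<open>5 * g - 4\<close> blocks are replaced by copies with \<open>5 * f - 4\<close> blocks
  each, the result has \<open>5 * f * g - 4\<close> blocks. At level 0,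
  \<open>3 * Suc m + 4 \<le> 5 * Suc m\<close> requires \<open>0 < m\<close>.\<close>

lemma scaffold_exists:
  assumes "d = 0 \<longrightarrow> 0 < m"
  shows "\<exists>Z :: nat segment list. scaffold (2 * d + 4) m Z \<and> specials Z = scaffold_size d m \<and>
    length (blocks Z) + 4 \<le> 5 * scaffold_size d m"
  using assms
proof (induction d m rule: scaffold_size.induct)
  case (1 m)
  obtain Z :: "nat segment list" where "scaffold 4 m Z" "specials Z = Suc m"
    "length (blocks Z) = 3 * Suc m"
    using scaffold_to_nat[OF scaffold_hubs[of "Suc m"]]
    by (auto simp: specials_hubs length_blocks_hubs simp del: upt_Suc)
  then show ?case using 1 by (intro exI[of _ Z]) auto
next
  case (2 d)
  show ?case by (intro exI[of _ "vacant 2"])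
    (use scaffold_vacant[of "2 * Suc d + 4" 2] in \<open>simp add: specials_vacant length_blocks_vacant\<close>)
next
  case (3 d m)
  let ?f = "scaffold_size (Suc d) m"
  let ?g = "scaffold_size d ?f"
  have "0 < ?f" using scaffold_size_gt[of m "Suc d"] by linarith
  then obtain Z :: "nat segment list" where Z: "scaffold (2 * d + 4) ?f Z" "specials Z = ?g"
    "length (blocks Z) + 4 \<le> 5 * ?g" using 3 by blast
  obtain Z' :: "nat segment list" where Z': "scaffold (2 * d + 4 + 2) m Z'" "specials Z' = ?f"
    "length (blocks Z') + 4 \<le> 5 * ?f" using 3 by auto
  have "length (blocks (substitute 0 Z' Z)) + 4 + ?g \<le> 5 * ?g + ?g * length (blocks Z')"
    using length_blocks_substitute[of 0 Z' Z] Z(3) unfolding Z(2) by linarith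
  also have "\<dots> + 4 * ?g = 5 * ?g + ?g * (length (blocks Z') + 4)" by algebra
  also have "\<dots> \<le> 5 * ?g + ?g * (5 * ?f)" using Z'(3) by simp
  finally have "length (blocks (substitute 0 Z' Z)) + 4 \<le> 5 * (?f * ?g)"
    by (simp add: algebra_simps)
  moreover have "scaffold (2 * d + 4 + 2) (Suc m) (substitute 0 Z' Z)"
    using Z(1) Z'(1) by (rule scaffold_substitute) (simp add: Z')
  ultimately show ?case
    using scaffold_to_nat[of "2 * d + 4 + 2" "Suc m" "substitute 0 Z' Z"] Z(2) Z'(2)
    by (simp add: specials_substitute mult.commute) metis
qed

text \<open>Each copy comes with the two empty neighbours of the vacant block it replaces; the slack
  4 in \<open>scaffold_exists\<close> pays for them.\<close>

lemma scaffold_copies: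
  fixes Z' :: "nat segment list"
  assumes "scaffold (k + 2) m Z'"
  shows "\<exists>Z :: nat segment list. scaffold (k + 2) m Z \<and> specials Z = q * specials Z' \<and>
    length (blocks Z) = q * (length (blocks Z') + 2)"
proof -
  let ?Z = "substitute 0 Z' (vacant q) :: (nat + nat \<times> nat) segment list"
  have "scaffold (k + 2) m ?Z"
    using scaffold_vacant assms by (rule scaffold_substitute) simp
  moreover have "specials ?Z = q * specials Z'"
    by (simp add: specials_substitute specials_vacant)
  moreover have "length (blocks ?Z) = q * (length (blocks Z') + 2)"
    using length_blocks_substitute[of 0 Z' "vacant q :: nat segment list"]
    by (simp add: specials_vacant length_blocks_vacant algebra_simps)
  ultimately show ?thesis using scaffold_to_nat[of "k + 2" m ?Z] by metis
qed

section \<open>Counting letters\<close>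

lemma count_list_marked:
  "count_list (map snd (filter (\<lambda>t. fst t \<noteq> Mid) w)) c = length (filter (\<lambda>k. k \<noteq> Mid) (trace c w))"
  by (induction w) auto

text \<open>Double counting of the entries of special blocks: each letter has exactly two, its first
  and its last.\<close>

lemma card_letters:
  assumes "scaffold k m Z"
  shows "2 * card (set (word Z)) = m * specials Z"
proof -
  let ?ys = "map snd (filter (\<lambda>t. fst t \<noteq> Mid) (tagged Z))"
  have "count_list ?ys c = 2" if c: "c \<in> set (word Z)" for c
  proof -
    obtain n where "trace c (tagged Z) = First # replicate n Mid @ [Last]"
      using assms c unfolding scaffold_def by blast
    then show ?thesis by (simp add: count_list_marked)
  qed
  moreover have "sum (count_list ?ys) (set (word Z)) = length ?ys"
    by (rule sum_count_set) (auto simp: word_def)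
  moreover have "length ?ys = m * specials Z" if "\<forall>S\<in>set Z. segment_ok m S"
    using that
  proof (induction Z)
    case (Cons S Z)
    then show ?case by (cases S) (auto simp: filter_map comp_def)
  qed simp
  ultimately show ?thesis using assms by (simp add: scaffold_def)
qed

lemma card_letters_in_letter_counts:
  fixes Z :: "nat segment list"
  assumes "scaffold k m Z" "length (blocks Z) \<le> M"
  shows "card (set (word Z)) \<in> letter_counts 5 k M"
proof -
  have "distinct b" if b: "b \<in> set (blocks Z)" for b
  proof -
    obtain S where "S \<in> set Z" "b \<in> set (blocks_segment S)" using b by (auto simp: blocks_def)
    moreover from this have "segment_ok m S" using assms(1) by (auto simp: scaffold_def)
    ultimately show ?thesis by (cases S rule: segment.exhaust) auto
  qed
  \<comment> \<open>Empty blocks pad the sequence to exactly \<open>M\<close> blocks.\<close>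
  then have "on_blocks M (word Z)"
    unfolding on_blocks_def
    by (intro exI[of _ "blocks Z @ replicate (M - length (blocks Z)) []"])
      (use assms(2) in \<open>auto simp: concat_blocks\<close>)
  moreover have "k \<le> count_list (word Z) c" if c: "c \<in> set (word Z)" for c
  proof -
    obtain n where "k \<le> n + 2" "trace c (tagged Z) = First # replicate n Mid @ [Last]"
      using assms(1) c unfolding scaffold_def by blast
    then show ?thesis using length_trace[of c Z] by simp
  qed
  moreover have "avoids_alternations 5 (word Z)" using assms(1) by (simp add: scaffold_def)
  ultimately show ?thesis
    unfolding letter_counts_def mem_Collect_eq by (intro exI[of _ "word Z"] conjI ballI refl)
qed

text \<open>Take \<open>q\<close> copies of the sequence of level \<open>d + 1\<close>; the factor 2
  stems from the two special entries per letter.\<close>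

lemma max_letters_ge:
  assumes "q * (5 * scaffold_size (Suc d) m) \<le> M"
  shows "m * (q * scaffold_size (Suc d) m) \<le> 2 * max_letters 5 (2 * d + 6) M"
proof -
  obtain Z' :: "nat segment list" where Z': "scaffold (2 * d + 4 + 2) m Z'"
    "specials Z' = scaffold_size (Suc d) m"
    "length (blocks Z') + 4 \<le> 5 * scaffold_size (Suc d) m"
    using scaffold_exists[of "Suc d" m] by auto
  obtain Z :: "nat segment list" where Z: "scaffold (2 * d + 4 + 2) m Z"
    "specials Z = q * specials Z'" "length (blocks Z) = q * (length (blocks Z') + 2)"
    using scaffold_copies[OF Z'(1)] by blast
  have "q * (length (blocks Z') + 2) \<le> q * (5 * scaffold_size (Suc d) m)"
    using Z'(3) by (intro mult_le_mono2) linarith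
  then have "length (blocks Z) \<le> M" using Z(3) assms by linarith
  moreover have "2 * d + 4 + 2 = 2 * d + (6 :: nat)" by simp
  then have "scaffold (2 * d + 6) m Z" using Z(1) by (simp only:)
  ultimately have "card (set (word Z)) \<in> letter_counts 5 (2 * d + 6) M"
    by (intro card_letters_in_letter_counts)
  then have "card (set (word Z)) \<le> max_letters 5 (2 * d + 6) M"
    unfolding max_letters_def by (intro Max_ge finite_letter_counts) auto
  then show ?thesis using card_letters[OF Z(1)] Z(2) Z'(2) by simp
qed

text \<open>Take the last \<open>n\<close> with \<open>5 * scaffold_size (Suc d) n \<le> M\<close>
  and as many copies as fit. The constant 20 combines 5 blocks per special block, a factor 2 from
  rounding down the number of copies, and two special entries per letter.\<close>

lemma max_letters_scale:
  assumes "5 * scaffold_size (Suc d) n0 \<le> M"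
  shows "\<exists>n\<ge>n0. M < 5 * scaffold_size (Suc d) (Suc n) \<and> n * M \<le> 20 * max_letters 5 (2 * d + 6) M"
proof -
  let ?P = "\<lambda>i. M < 5 * scaffold_size (Suc d) i"
  have "?P M" using scaffold_size_gt[of M "Suc d"] by linarith
  moreover have "\<not> ?P 0" using assms scaffold_size_mono[of 0 n0 d] by linarith
  ultimately obtain n where n: "\<forall>i\<le>n. \<not> ?P i" "?P (Suc n)"
    using ex_least_nat_less[of ?P M] by blast
  have "n0 \<le> n"
  proof (rule ccontr)
    assume "\<not> n0 \<le> n"
    then show False using n(2) assms scaffold_size_mono[of "Suc n" n0 d] by linarith
  qed
  moreover have "n * M \<le> 20 * max_letters 5 (2 * d + 6) M"
  proof -
    let ?s = "scaffold_size (Suc d) n"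
    let ?q = "M div (5 * ?s)"
    have "0 < 5 * ?s" using scaffold_size_gt[of n "Suc d"] by simp
    moreover have "5 * ?s \<le> M" using n(1) by (simp add: not_less)
    ultimately have "0 < ?q" by (simp add: div_greater_zero_iff)
    then have "?s \<le> ?q * ?s" by simp
    moreover have "M < 5 * ?s + ?q * (5 * ?s)"
      using dividend_less_div_times[OF \<open>0 < 5 * ?s\<close>, of M] .
    moreover have "?q * (5 * ?s) = 5 * (?q * ?s)" by simp
    ultimately have "M \<le> 10 * (?q * ?s)" by linarith
    then have "n * M \<le> n * (10 * (?q * ?s))" by (rule mult_le_mono2)
    also have "\<dots> = 10 * (n * (?q * ?s))" by simp
    also have "\<dots> \<le> 10 * (2 * max_letters 5 (2 * d + 6) M)"
      by (intro mult_le_mono2 max_letters_ge) simp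
    finally show ?thesis by simp
  qed
  ultimately show ?thesis using n(2) by blast
qed

section \<open>Comparison with the Ackermann hierarchy\<close>

text \<open>The shift skips the dummy level and the doubling function, so that
  \<open>ack 0 n\<close> is \<open>2 ^ n\<close>.\<close>

abbreviation ack :: "nat \<Rightarrow> nat \<Rightarrow> nat" where
  "ack j \<equiv> ack_hier (Suc (Suc j))"

lemma double_le_power2: "2 * x \<le> 2 ^ x" for x :: nat
proof (induction x)
  case (Suc x)
  have "2 ^ 1 \<le> (2 :: nat) ^ x" if "0 < x" using that by (intro power_increasing) auto
  then show ?case using Suc by (cases "x = 0") auto
qed simp

lemma five_times_le_power2: "5 \<le> x \<Longrightarrow> 5 * x \<le> 2 ^ x" for x :: nat
  by (induction x rule: dec_induct) auto

lemma ack_0: "ack 0 n = 2 ^ n"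
  by (induction n) auto

lemma power2_le_ack: "2 ^ n \<le> ack j n"
proof (induction j arbitrary: n)
  case 0
  then show ?case by (simp add: ack_0)
next
  case (Suc j)
  show ?case
  proof (induction n)
    case (Suc n)
    have "2 ^ Suc n \<le> (2 :: nat) ^ 2 ^ n"
      by (intro power_increasing) (simp_all add: Suc_leI)
    also have "\<dots> \<le> 2 ^ ack (Suc j) n" using Suc by (intro power_increasing) auto
    also have "\<dots> \<le> ack j (ack (Suc j) n)" by fact
    finally show ?case by simp
  qed simp
qed

lemma two_times_ack_le: "2 * ack j n \<le> ack j (Suc n)"
proof (cases j)
  case 0
  then show ?thesis by (simp add: ack_0)
next
  case (Suc i)
  have "2 * ack j n \<le> 2 ^ ack j n" by (rule double_le_power2)
  also have "\<dots> \<le> ack i (ack j n)" by (rule power2_le_ack)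
  finally show ?thesis using Suc by simp
qed

lemma power2_times_ack_le: "2 ^ y * ack j x \<le> ack j (x + y)"
proof (induction y)
  case (Suc y)
  have "2 ^ Suc y * ack j x \<le> 2 * ack j (x + y)" using Suc by simp
  also have "\<dots> \<le> ack j (x + Suc y)" using two_times_ack_le by simp
  finally show ?case .
qed simp

lemma ack_mono: "x \<le> y \<Longrightarrow> ack j x \<le> ack j y"
  using lift_Suc_mono_le[of "ack j"] two_times_ack_le[of j] by (metis le_add1 mult_2 order_trans)

lemma le_ack: "x \<le> ack j x"
  using power2_le_ack[of x j] less_exp[of x] by linarith

lemma ack_add_le: "ack j x + y \<le> ack j (x + y)"
proof -
  have "1 \<le> ack j x" using power2_le_ack[of x j] by (meson one_le_numeral one_le_power order_trans)
  then have "y * 1 \<le> y * ack j x" by (rule mult_le_mono2)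
  then have "ack j x + y \<le> (Suc y) * ack j x" by simp
  also have "\<dots> \<le> 2 ^ y * ack j x" by (intro mult_le_mono1) (simp add: Suc_leI)
  also have "\<dots> \<le> ack j (x + y)" by (rule power2_times_ack_le)
  finally show ?thesis .
qed

text \<open>One step sends \<open>f\<close> to \<open>f * (f + 1)\<close>; for \<open>f + 1\<close>
  this is at most squaring, which doubles the exponent.\<close>

lemma scaffold_size_1_bound: "scaffold_size (Suc 0) m + 1 \<le> 2 ^ 2 ^ Suc m"
proof (induction m)
  case (Suc m)
  let ?f = "scaffold_size (Suc 0) m"
  have "scaffold_size (Suc 0) (Suc m) + 1 \<le> (?f + 1) * (?f + 1)" by simp
  also have "\<dots> \<le> 2 ^ 2 ^ Suc m * 2 ^ 2 ^ Suc m" using Suc by (intro mult_le_mono)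
  also have "\<dots> = 2 ^ 2 ^ Suc (Suc m)" by (simp flip: power_add mult_2)
  finally show ?case .
qed simp

text \<open>Each step in \<open>m\<close> costs three applications of \<open>ack d\<close>, hence
  \<open>3 * m\<close>: two come from the hypothesis, and one absorbs the argument
  \<open>3 * ?F + c\<close> together with the factor \<open>?F\<close>. The summand
  \<open>c + 5\<close> guarantees \<open>c \<le> ?F\<close> and
  \<open>5 * ?F \<le> 2 ^ ?F\<close>.\<close>

lemma scaffold_size_step:
  assumes "\<And>m. scaffold_size (Suc d) m \<le> ack d (ack d (3 * m + c))"
  shows "scaffold_size (Suc (Suc d)) m \<le> ack (Suc d) (3 * m + (c + 5))"
proof (induction m)
  case 0
  have "2 ^ 1 \<le> (2 :: nat) ^ (c + 5)" by (rule power_increasing) auto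
  also have "\<dots> \<le> ack (Suc d) (c + 5)" by (rule power2_le_ack)
  finally show ?case by simp
next
  case (Suc m)
  let ?f = "scaffold_size (Suc (Suc d)) m"
  let ?F = "ack (Suc d) (3 * m + (c + 5))"
  have F: "c + 5 \<le> ?F" using le_ack[of "3 * m + (c + 5)" "Suc d"] by linarith
  have "scaffold_size (Suc (Suc d)) (Suc m) = ?f * scaffold_size (Suc d) ?f" by simp
  also have "\<dots> \<le> ?F * ack d (ack d (3 * ?F + c))"
  proof (rule mult_le_mono[OF Suc])
    have "scaffold_size (Suc d) ?f \<le> scaffold_size (Suc d) ?F"
      using Suc by (rule scaffold_size_mono)
    also have "\<dots> \<le> ack d (ack d (3 * ?F + c))" by (rule assms)
    finally show "scaffold_size (Suc d) ?f \<le> ack d (ack d (3 * ?F + c))" .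
  qed
  also have "\<dots> \<le> 2 ^ ?F * ack d (ack d (3 * ?F + c))"
    using less_exp[of ?F] by (intro mult_le_mono1) linarith
  also have "\<dots> \<le> ack d (ack d (3 * ?F + c) + ?F)" by (rule power2_times_ack_le)
  also have "\<dots> \<le> ack d (ack d (ack d ?F))"
  proof (intro ack_mono)
    have "ack d (3 * ?F + c) + ?F \<le> ack d (3 * ?F + c + ?F)" by (rule ack_add_le)
    also have "\<dots> \<le> ack d (ack d ?F)"
    proof (rule ack_mono)
      have "3 * ?F + c + ?F \<le> 5 * ?F" using F by linarith
      also have "\<dots> \<le> 2 ^ ?F" using F by (intro five_times_le_power2) linarith
      also have "\<dots> \<le> ack d ?F" by (rule power2_le_ack)
      finally show "3 * ?F + c + ?F \<le> ack d ?F" .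
    qed
    finally show "ack d (3 * ?F + c) + ?F \<le> ack d (ack d ?F)" .
  qed
  also have "ack d (ack d (ack d ?F)) = ack (Suc d) (Suc (Suc (Suc (3 * m + (c + 5)))))"
    by (simp only: ack_hier.simps)
  also have "Suc (Suc (Suc (3 * m + (c + 5)))) = 3 * Suc m + (c + 5)" by simp
  finally show ?case .
qed

text \<open>Level 1 grows doubly exponentially but \<open>ack 0\<close> only exponentially, so the
  start takes two applications. From \<open>d = 1\<close> on one suffices, and \<open>le_ack\<close>
  weakens the bound to the common form.\<close>

lemma scaffold_size_le_ack_ack: "\<exists>c. \<forall>m. scaffold_size (Suc d) m \<le> ack d (ack d (3 * m + c))"
proof (induction d)
  case 0
  have "scaffold_size (Suc 0) m \<le> ack 0 (ack 0 (3 * m + 1))" for m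
  proof -
    have "scaffold_size (Suc 0) m \<le> 2 ^ 2 ^ Suc m" using scaffold_size_1_bound[of m] by simp
    also have "\<dots> \<le> 2 ^ 2 ^ (3 * m + 1)" by (intro power_increasing) auto
    finally show ?thesis by (simp only: ack_0)
  qed
  then show ?case by blast
next
  case (Suc d)
  then obtain c where "\<And>m. scaffold_size (Suc d) m \<le> ack d (ack d (3 * m + c))" by blast
  then have "scaffold_size (Suc (Suc d)) m \<le> ack (Suc d) (3 * m + (c + 5))" for m
    by (rule scaffold_size_step)
  then show ?case using le_ack order_trans by blast
qed

lemma scaffold_size_le_ack: "\<exists>c. \<forall>m. scaffold_size (Suc (Suc d)) m \<le> ack (Suc d) (3 * m + c)"
  using scaffold_size_le_ack_ack[of d] scaffold_size_step by blast

section \<open>The two lower bounds\<close>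

lemma max_letters_ge_inv_ack:
  assumes "3 \<le> d"
  shows "\<exists>m0. \<forall>m\<ge>m0. m * inv_ack d m \<le> 80 * max_letters 5 (2 * d + 2) m"
proof -
  obtain e where d: "d = Suc (Suc (Suc e))"
    using assms by (metis Suc_le_D numeral_3_eq_3 Suc_le_mono)
  obtain c where c: "\<And>m. scaffold_size (Suc (Suc e)) m \<le> ack (Suc e) (3 * m + c)"
    using scaffold_size_le_ack by blast
  have k: "2 * Suc e + 6 = 2 * d + 2" using d by simp
  show ?thesis
  proof (intro exI allI impI)
    \<comment> \<open>The argument \<open>c + 6\<close> is chosen to give
      \<open>3 * Suc n + c + 3 \<le> 4 * n\<close>.\<close>
    fix m assume "5 * scaffold_size (Suc (Suc e)) (c + 6) \<le> m"
    then obtain n where n: "c + 6 \<le> n" "m < 5 * scaffold_size (Suc (Suc e)) (Suc n)"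
      "n * m \<le> 20 * max_letters 5 (2 * d + 2) m"
      using max_letters_scale[of "Suc e" "c + 6" m] unfolding k by blast
    \<comment> \<open>The factor 5 is rounded up to \<open>2 ^ 3\<close>, which costs 3 in the
      argument of \<open>ack\<close>.\<close>
    have "m \<le> 2 ^ 3 * ack (Suc e) (3 * Suc n + c)"
      using n(2) c[of "Suc n"] by simp
    also have "\<dots> \<le> ack (Suc e) (3 * Suc n + c + 3)" by (rule power2_times_ack_le)
    also have "\<dots> \<le> ack (Suc e) (4 * n)" using n(1) by (intro ack_mono) simp
    finally have "inv_ack d m \<le> 4 * n"
      unfolding inv_ack_def d by (rule Least_le)
    then have "m * inv_ack d m \<le> m * (4 * n)" by (rule mult_le_mono2)
    also have "\<dots> = 4 * (n * m)" by simp
    also have "\<dots> \<le> 80 * max_letters 5 (2 * d + 2) m" using n(3) by linarith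
    finally show "m * inv_ack d m \<le> 80 * max_letters 5 (2 * d + 2) m" .
  qed
qed

text \<open>The threshold 30 is \<open>5 * scaffold_size 1 1\<close>. It gives
  \<open>n \<ge> 1\<close> and so \<open>n + 3 \<le> 4 * n\<close>; with the 20 from
  \<open>max_letters_scale\<close> this makes 80.\<close>

lemma max_letters_ge_ln_ln:
  assumes "30 \<le> m"
  shows "real m * ln (ln (real m)) \<le> 80 * real (max_letters 5 6 m)"
proof -
  have "5 * scaffold_size (Suc 0) 1 \<le> m" using assms by simp
  then obtain n where n: "1 \<le> n" "m < 5 * scaffold_size (Suc 0) (Suc n)"
    "n * m \<le> 20 * max_letters 5 6 m"
    using max_letters_scale[of 0 1 m] by auto
  have "m \<le> 2 ^ 3 * 2 ^ 2 ^ Suc (Suc n)" using n(2) scaffold_size_1_bound[of "Suc n"] by simp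
  also have "\<dots> = (2 :: nat) ^ (3 + 2 ^ Suc (Suc n))" by (rule power_add[symmetric])
  also have "\<dots> \<le> 2 ^ 2 ^ (n + 3)"
  proof (rule power_increasing)
    have "(2 :: nat) ^ 1 \<le> 2 ^ n" using n(1) by (rule power_increasing) simp
    then show "3 + 2 ^ Suc (Suc n) \<le> (2 :: nat) ^ (n + 3)" by (simp add: power_add)
  qed simp
  finally have "real m \<le> 2 ^ 2 ^ (n + 3)" by (metis of_nat_le_iff of_nat_numeral of_nat_power)
  then have "ln (real m) \<le> ln (2 ^ 2 ^ (n + 3))" using assms by (intro ln_mono) auto
  also have "\<dots> = 2 ^ (n + 3) * ln 2" by (simp add: ln_realpow)
  also have "\<dots> \<le> 2 ^ (n + 3) * 1" using ln_2_less_1 by (intro mult_left_mono) auto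
  finally have "ln (real m) \<le> 2 ^ (n + 3)" by simp
  moreover have "0 < ln (real m)" using assms by simp
  ultimately have "ln (ln (real m)) \<le> ln (2 ^ (n + 3))" by (intro ln_mono) auto
  also have "\<dots> = real (n + 3) * ln 2" by (simp only: ln_realpow zero_less_numeral)
  also have "\<dots> \<le> real (n + 3) * 1" using ln_2_less_1 by (intro mult_left_mono) auto
  also have "\<dots> \<le> 4 * real n" using n(1) by simp
  finally have "real m * ln (ln (real m)) \<le> real m * (4 * real n)" by (intro mult_left_mono) auto
  also have "\<dots> = 4 * real (n * m)" by simp
  also have "\<dots> \<le> 4 * real (20 * max_letters 5 6 m)" using n(3) by (intro mult_left_mono) linarith+
  finally show ?thesis by simp
qed

theorem lemma3p2:
  shows "(\<lambda>m. real (max_letters 5 6 m)) \<in> \<Omega>(\<lambda>m. real m * ln (ln (real m))) \<and>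
    (\<exists>c::real. c > 0 \<and>
      (\<forall>d\<ge>3. \<exists>m0. \<forall>m\<ge>m0.
         real (max_letters 5 (2 * d + 2) m) \<ge> c / real d * real m * real (inv_ack d m)))"
proof
  have "eventually (\<lambda>m. norm (real (max_letters 5 6 m)) \<ge>
      1 / 80 * norm (real m * ln (ln (real m)))) sequentially"
    using eventually_ge_at_top[of 30]
  proof eventually_elim
    case (elim m)
    have "exp 1 \<le> real m" using elim exp_le by linarith
    then have "1 \<le> ln (real m)" using elim by (subst ln_ge_iff) auto
    then show ?case using max_letters_ge_ln_ln[OF elim] by simp
  qed
  then show "(\<lambda>m. real (max_letters 5 6 m)) \<in> \<Omega>(\<lambda>m. real m * ln (ln (real m)))"
    by (intro landau_omega.bigI[of "1 / 80"]) auto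
next
  show "\<exists>c::real. c > 0 \<and> (\<forall>d\<ge>3. \<exists>m0. \<forall>m\<ge>m0.
      real (max_letters 5 (2 * d + 2) m) \<ge> c / real d * real m * real (inv_ack d m))"
  proof (intro exI[of _ "1 / 80"] conjI allI impI)
    fix d :: nat assume d: "3 \<le> d"
    then obtain m0 where m0: "\<forall>m\<ge>m0. m * inv_ack d m \<le> 80 * max_letters 5 (2 * d + 2) m"
      using max_letters_ge_inv_ack by blast
    show "\<exists>m0. \<forall>m\<ge>m0. 1 / 80 / real d * real m * real (inv_ack d m)
        \<le> real (max_letters 5 (2 * d + 2) m)"
    proof (intro exI[of _ m0] allI impI)
      fix m assume "m0 \<le> m"
      then have "real (m * inv_ack d m) \<le> real (80 * max_letters 5 (2 * d + 2) m)"
        using m0 of_nat_le_iff by blast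
      then have bound: "real m * real (inv_ack d m) \<le> 80 * real (max_letters 5 (2 * d + 2) m)"
        by simp
      have "1 / 80 / real d * real m * real (inv_ack d m) =
          1 / 80 / real d * (real m * real (inv_ack d m))" by (rule mult.assoc)
      \<comment> \<open>The bound holds with a constant free of \<open>d\<close>, and dividing by
        \<open>d\<close> only weakens it.\<close>
      also have "\<dots> \<le> 1 / 80 * (real m * real (inv_ack d m))"
        using d by (intro mult_right_mono) (auto simp: field_simps)
      also have "\<dots> \<le> real (max_letters 5 (2 * d + 2) m)" using bound by linarith
      finally show "1 / 80 / real d * real m * real (inv_ack d m)
          \<le> real (max_letters 5 (2 * d + 2) m)" .
    qed
  qed simp
qed

end
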